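(* Consider a finite discounted MDP and let $\bar\rho$ be the joint spectral radius of the restricted family $\{\bar A_\pi:\pi\in\Theta\}$. If some deterministic policy $\pi\in\Theta$ satisfies $|\lambda_2(P_\pi)|=1$, then $\rho(\bar A_\pi)=\gamma$ (spectral radius) and $\bar\rho=\gamma$. In particular, if for some $\pi\in\Theta$ the Markov chain on $\mathcal S$ with transition matrix $P_\pi$ has more than one closed communicating class, or has a periodic closed communicating class, then $\bar\rho=\gamma$; hence a necessary condition for $\bar\rho<\gamma$ is that for every deterministic policy $\pi$ the chain $P_\pi$ be unichain and aperiodic.
   Context: Finite discounted MDP: finite nonempty state set $\mathcal S$ and action set $\mathcal A$, transition probabilities $P(s'|s,a)$, discount $\gamma\in(0,1)$. Put $n=|\mathcal S||\mathcal A|$. $P$ also denotes the $n\times|\mathcal S|$ matrix with entry $P(s'|s,a)$ in row $(s,a)$, column $s'$. For a deterministic policy $\pi:\mathcal S\to\mathcal A$, $\Pi^\pi$ is the $|\mathcal S|\times n$ matrix with $(\Pi^\pi Q)(s)=Q(s,\pi(s))$. $\Theta$ is the (finite) set of all deterministic policies. $P_\pi:=\Pi^\pi P\in\mathbb R^{|\mathcal S|\times|\mathcal S|}$ is the state transition matrix under $\pi$, i.e. $P_\pi(s,s')=P(s'|s,\pi(s))$. List the eigenvalues of $P_\pi$ with algebraic multiplicity over $\mathbb C$, remove one copy of the Perron eigenvalue $1$ (associated with the constant vector); $\lambda_2(P_\pi)$ denotes a remaining eigenvalue of largest modulus (so the hypothesis requires $|\mathcal S|\ge2$). $\mathbf\Pi_\perp:=I-\frac1n\mathbf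 1\mathbf 1^\top$ with $\mathbf 1\in\mathbb R^n$ the all-ones vector, $\bar A_\pi:=\mathbf\Pi_\perp(\gamma P\Pi^\pi)\mathbf\Pi_\perp$. Joint spectral radius of a finite set of matrices: $\rho(M_1,\dots,M_m)=\lim_{k\to\infty}\max_{\sigma\in\{1,\dots,m\}^k}\|M_{\sigma_k}\cdots M_{\sigma_1}\|^{1/k}$ (any submultiplicative norm). A closed communicating class is a communicating class with no transition to states outside it; it is periodic if the gcd of its possible return times is larger than one. Unichain means exactly one closed communicating class, possibly with transient states; "unichain and aperiodic" means this unique closed class is aperiodic. *)

theory Defs
  imports
    "HOL-Analysis.Analysis"
    "HOL-Computational_Algebra.Computational_Algebra"
begin

section \<open>Finite Markov decision processes\<close>

text \<open>
  States and actions are the elements of finite types \<open>'s\<close> and \<open>'a\<close>; types are nonempty.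
  The space \<open>\<real>\<^sup>n\<close> with \<open>n = |S||A|\<close> is \<open>real ^ ('s \<times> 'a)\<close>.  The transition
  probabilities are given by the matrix \<open>P\<close> with \<open>P $ (s, a) $ s' = P(s'|s,a)\<close>, and the set of
  deterministic policies is the whole function type \<open>'s \<Rightarrow> 'a\<close>.  Rewards play no role.
\<close>

definition transition_kernel :: "real^'s^('s::finite \<times> 'a::finite) \<Rightarrow> bool" where
  "transition_kernel P \<longleftrightarrow>
     (\<forall>sa s'. 0 \<le> P $ sa $ s') \<and> (\<forall>sa. (\<Sum>s'\<in>UNIV. P $ sa $ s') = 1)"

definition policy_matrix :: "('s::finite \<Rightarrow> 'a::finite) \<Rightarrow> real^('s \<times> 'a)^'s" where
  "policy_matrix \<pi> = (\<chi> s sa. if sa = (s, \<pi> s) then 1 else 0)"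

definition state_transition_matrix ::
  "real^'s^('s::finite \<times> 'a::finite) \<Rightarrow> ('s \<Rightarrow> 'a) \<Rightarrow> real^'s^'s" where
  "state_transition_matrix P \<pi> = policy_matrix \<pi> ** P"

definition centering_matrix :: "real^'n^'n" where
  "centering_matrix = mat 1 - (1 / real CARD('n)) *\<^sub>R (\<chi> i j. 1)"

definition projected_matrix ::
  "real \<Rightarrow> real^'s^('s::finite \<times> 'a::finite) \<Rightarrow> ('s \<Rightarrow> 'a) \<Rightarrow> real^('s \<times> 'a)^('s \<times> 'a)" where
  "projected_matrix \<gamma> P \<pi> =
     centering_matrix ** (\<gamma> *\<^sub>R (P ** policy_matrix \<pi>)) ** centering_matrix"


section \<open>Eigenvalues\<close>

definition complex_charpoly :: "real^'n^'n \<Rightarrow> complex poly" where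
  "complex_charpoly M = det (mat [:0, 1:] - (\<chi> i j. [:complex_of_real (M $ i $ j):]))"

text \<open>The complex eigenvalues, each repeated according to its algebraic multiplicity.\<close>

definition eigenvalues :: "real^'n^'n \<Rightarrow> complex multiset" where
  "eigenvalues M = proots (complex_charpoly M)"

definition spec_radius :: "real^'n^'n \<Rightarrow> real" where
  "spec_radius M = Max (cmod ` set_mset (eigenvalues M))"

text \<open>
  \<open>is_second_eigenvalue M z\<close>: \<open>z\<close> has largest modulus among the eigenvalues that remain after one
  copy of the Perron eigenvalue \<open>1\<close> is removed.  All such \<open>z\<close> have the same modulus; there is
  none if \<open>M\<close> is a 1-by-1 stochastic matrix.
\<close>

definition is_second_eigenvalue :: "real^'n^'n \<Rightarrow> complex \<Rightarrow> bool" where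
  "is_second_eigenvalue M z \<longleftrightarrow>
     z \<in># eigenvalues M - {#1#} \<and> (\<forall>w. w \<in># eigenvalues M - {#1#} \<longrightarrow> cmod w \<le> cmod z)"


section \<open>Joint spectral radius\<close>

text \<open>For \<open>w = [M\<^sub>1, \<dots>, M\<^sub>k]\<close> this is the product of \<open>M\<^sub>k\<close>, ..., \<open>M\<^sub>1\<close>, in this order.\<close>

definition word_product :: "(real^'n^'n) list \<Rightarrow> real^'n^'n" where
  "word_product w = fold (\<lambda>M X. M ** X) w (mat 1)"

text \<open>The submultiplicative norm is the operator norm induced by the Euclidean norm.\<close>

definition joint_spectral_radius :: "(real^'n^'n) set \<Rightarrow> real" where
  "joint_spectral_radius \<M> =
     lim (\<lambda>k. Max ((\<lambda>w. root k (onorm ((*v) (word_product w)))) `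
                    {w. length w = k \<and> set w \<subseteq> \<M>}))"


section \<open>Classification of states\<close>

definition transitions :: "real^'s^'s \<Rightarrow> ('s \<times> 's) set" where
  "transitions M = {(i, j). M $ i $ j > 0}"

definition communicating_classes :: "real^'s^'s \<Rightarrow> 's set set" where
  "communicating_classes M =
     UNIV // {(i, j). (i, j) \<in> (transitions M)\<^sup>* \<and> (j, i) \<in> (transitions M)\<^sup>*}"

definition closed_classes :: "real^'s^'s \<Rightarrow> 's set set" where
  "closed_classes M = {C \<in> communicating_classes M. transitions M `` C \<subseteq> C}"

definition return_times :: "real^'s^'s \<Rightarrow> 's set \<Rightarrow> nat set" where
  "return_times M C = {k. k > 0 \<and> (\<exists>i\<in>C. (i, i) \<in> transitions M ^^ k)}"

definition periodic_class :: "real^'s^'s \<Rightarrow> 's set \<Rightarrow> bool" where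
  "periodic_class M C \<longleftrightarrow> Gcd (return_times M C) > 1"

definition unichain :: "real^'s^'s \<Rightarrow> bool" where
  "unichain M \<longleftrightarrow> (\<exists>!C. C \<in> closed_classes M)"

definition unichain_aperiodic :: "real^'s^'s \<Rightarrow> bool" where
  "unichain_aperiodic M \<longleftrightarrow> unichain M \<and> (\<forall>C\<in>closed_classes M. \<not> periodic_class M C)"

end

theory Submission
  imports Defs
begin

no_notation fps_nth (infixl \<open>$\<close> 75)

text \<open>
  A stochastic matrix \<open>M\<close> fixes the constants, so \<open>C M C = C M\<close> for the centering projection
  \<open>C\<close>.  Hence a product of \<open>k\<close> matrices of the family is \<open>\<gamma>\<^sup>k C T\<close> with \<open>T\<close> stochastic, and its
  norm is at most a constant times \<open>\<gamma>\<^sup>k\<close>.  It remains to find one policy whose powers have norm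
  at least a constant times \<open>\<gamma>\<^sup>k\<close>; then the limit exists and equals \<open>\<gamma>\<close>.  A second eigenvalue
  \<open>z\<close> of modulus one has an eigenvector modulo constants, which \<open>C P\<close> maps to an eigenvector of the
  projected matrix for \<open>\<gamma> z\<close>.  If there are two closed classes or a periodic one, then the
  indicator of a closed class, or of a cyclic subclass, keeps oscillation one under all powers of
  the chain.
\<close>

section \<open>Complexification of real matrices\<close>

definition complex_matrix :: "real^'n^'m \<Rightarrow> complex^'n^'m" where
  "complex_matrix A = (\<chi> i j. complex_of_real (A $ i $ j))"

lemma complex_matrix_mult: "complex_matrix (A ** B) = complex_matrix A ** complex_matrix B"
  by (simp add: complex_matrix_def matrix_matrix_mult_def vec_eq_iff)

lemma complex_matrix_scaleR_vector:
  "complex_matrix (r *\<^sub>R A) *v x = complex_of_real r *s (complex_matrix A *v x)"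
  by (simp add: complex_matrix_def matrix_vector_mult_def vec_eq_iff sum_distrib_left mult.assoc)

lemma complex_matrix_one: "complex_matrix (mat 1) = mat 1"
  by (simp add: complex_matrix_def mat_def vec_eq_iff)

lemma norm_complex_vector_eq:
  fixes v :: "complex^'n"
  shows "(norm v)\<^sup>2 = (norm (\<chi> i. Re (v $ i)))\<^sup>2 + (norm (\<chi> i. Im (v $ i)))\<^sup>2"
  by (simp add: norm_vec_def L2_set_def sum_nonneg cmod_power2 flip: sum.distrib)

text \<open>The real and imaginary parts of a complex vector are mapped separately, so complexifying a
  real matrix does not increase its Euclidean operator norm.\<close>

lemma norm_complex_matrix_vector_le:
  fixes A :: "real^'n^'m"
  shows "norm (complex_matrix A *v v) \<le> onorm ((*v) A) * norm v"
proof (rule power2_le_imp_le)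
  let ?x = "\<chi> i. Re (v $ i)" and ?y = "\<chi> i. Im (v $ i)"
  have re: "(\<chi> i. Re ((complex_matrix A *v v) $ i)) = A *v ?x"
    and im: "(\<chi> i. Im ((complex_matrix A *v v) $ i)) = A *v ?y"
    by (simp_all add: complex_matrix_def matrix_vector_mult_def vec_eq_iff)
  have b: "norm (A *v x) \<le> onorm ((*v) A) * norm x" for x
    by (rule onorm) simp
  have "(norm (complex_matrix A *v v))\<^sup>2 = (norm (A *v ?x))\<^sup>2 + (norm (A *v ?y))\<^sup>2"
    by (simp only: norm_complex_vector_eq[of "complex_matrix A *v v"] re im)
  also have "\<dots> \<le> (onorm ((*v) A) * norm ?x)\<^sup>2 + (onorm ((*v) A) * norm ?y)\<^sup>2"
    by (intro add_mono power_mono b) auto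
  also have "\<dots> = (onorm ((*v) A) * norm v)\<^sup>2"
    by (simp add: power_mult_distrib norm_complex_vector_eq[of v] distrib_left)
  finally show "(norm (complex_matrix A *v v))\<^sup>2 \<le> (onorm ((*v) A) * norm v)\<^sup>2" .
  show "0 \<le> onorm ((*v) A) * norm v"
    by (simp add: onorm_pos_le)
qed


section \<open>Eigenvalues and the characteristic polynomial\<close>

lemma poly_det:
  fixes A :: "'a::comm_ring_1 poly^'n^'n"
  shows "poly (det A) x = det (\<chi> i j. poly (A $ i $ j) x)"
  by (simp add: det_def poly_sum poly_prod poly_mult)

lemma poly_complex_charpoly:
  "poly (complex_charpoly A) z = det (mat z - complex_matrix A)"
  unfolding complex_charpoly_def poly_det
  by (rule arg_cong[where f = det])
    (simp add: vec_eq_iff mat_def complex_matrix_def)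

lemma det_eq_0_iff_kernel:
  fixes A :: "'a::field^'n^'n"
  shows "det A = 0 \<longleftrightarrow> (\<exists>v. v \<noteq> 0 \<and> A *v v = 0)"
  using invertible_det_nz[of A] matrix_left_invertible_ker[of A]
  by (auto simp: invertible_left_inverse)

lemma mat_vector_mult: "mat z *v v = z *s v" for v :: "'a::comm_ring_1^'n"
  by (simp add: matrix_vector_mult_def mat_def vec_eq_iff if_distrib if_distribR cong: if_cong)

lemma poly_complex_charpoly_eq_0_iff:
  "poly (complex_charpoly A) z = 0 \<longleftrightarrow> (\<exists>v. v \<noteq> 0 \<and> complex_matrix A *v v = z *s v)"
  unfolding poly_complex_charpoly det_eq_0_iff_kernel
  by (auto simp: matrix_vector_mult_diff_rdistrib mat_vector_mult)

text \<open>Adding all other columns to column \<open>i\<close> does not change the determinant; the new column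
  is constant.\<close>

lemma det_constant_row_sums:
  fixes A :: "'a::comm_ring_1^'n^'n"
  assumes "\<And>r. (\<Sum>j\<in>UNIV. A $ r $ j) = c"
  shows "det A = c * det (\<chi> r j. if j = i then 1 else A $ r $ j)"
proof -
  let ?B = "transpose A"
  have *: "det (\<chi> k. if k = i then row j ?B else row k ?B) = 0" if "j \<noteq> i" for j
    by (rule det_identical_rows[OF that]) (use that in \<open>simp add: row_def vec_eq_iff\<close>)
  have "det (\<chi> k. if k = i then (\<Sum>j\<in>UNIV. row j ?B) else row k ?B)
      = (\<Sum>j\<in>UNIV. det (\<chi> k. if k = i then row j ?B else row k ?B))"
    by (rule det_linear_row_sum) simp
  also have "\<dots> = (\<Sum>j\<in>UNIV. if j = i then det ?B else 0)"
  proof (rule sum.cong[OF refl])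
    fix j
    have "(\<chi> k. if k = i then row i ?B else row k ?B) = ?B"
      by (simp add: vec_eq_iff row_def)
    then show "det (\<chi> k. if k = i then row j ?B else row k ?B) = (if j = i then det ?B else 0)"
      using * by auto
  qed
  also have "\<dots> = det A"
    by simp
  finally have "det A = det (\<chi> k. if k = i then (\<Sum>j\<in>UNIV. row j ?B) else row k ?B)" ..
  also have "(\<chi> k. if k = i then (\<Sum>j\<in>UNIV. row j ?B) else row k ?B)
      = (\<chi> k. if k = i then c *s 1 else row k ?B)"
    using assms by (simp add: vec_eq_iff row_def transpose_def)
  also have "det \<dots> = c * det (\<chi> k. if k = i then 1 else row k ?B)"
    by (rule det_row_mul)
  also have "(\<chi> k. if k = i then 1 else row k ?B)
      = transpose (\<chi> r j. if j = i then 1 else A $ r $ j)"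
    by (simp add: vec_eq_iff row_def transpose_def)
  finally show ?thesis
    by simp
qed


section \<open>Stochastic matrices and the centering projection\<close>

definition stochastic :: "real^'n^'m \<Rightarrow> bool" where
  "stochastic A \<longleftrightarrow> (\<forall>i j. 0 \<le> A $ i $ j) \<and> (\<forall>i. (\<Sum>j\<in>UNIV. A $ i $ j) = 1)"

text \<open>The projection onto the constants. It is itself stochastic, so
  \<open>centering_matrix ** T\<close> becomes a difference of two stochastic matrices.\<close>

definition averaging_matrix :: "real^'n^'n" where
  "averaging_matrix = (\<chi> i j. 1 / real CARD('n))"

lemma centering_matrix_eq: "centering_matrix = mat 1 - averaging_matrix"
  by (simp add: centering_matrix_def averaging_matrix_def vec_eq_iff)

lemma stochastic_averaging_matrix: "stochastic averaging_matrix"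
  by (simp add: stochastic_def averaging_matrix_def)

lemma stochastic_mult:
  assumes "stochastic A" "stochastic B"
  shows "stochastic (A ** B)"
proof -
  have "(\<Sum>j\<in>UNIV. (A ** B) $ i $ j) = 1" for i
  proof -
    have "(\<Sum>j\<in>UNIV. (A ** B) $ i $ j) = (\<Sum>k\<in>UNIV. A $ i $ k * (\<Sum>j\<in>UNIV. B $ k $ j))"
      unfolding matrix_matrix_mult_def sum_distrib_left vec_lambda_beta by (rule sum.swap)
    then show ?thesis
      using assms by (simp add: stochastic_def)
  qed
  then show ?thesis
    using assms by (auto simp: stochastic_def matrix_matrix_mult_def intro!: sum_nonneg)
qed

lemma stochastic_mult_averaging:
  "stochastic A \<Longrightarrow> A ** averaging_matrix = averaging_matrix"
  by (simp add: stochastic_def averaging_matrix_def matrix_matrix_mult_def vec_eq_iff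
      flip: sum_divide_distrib)

lemma matrix_sub_ldistrib_real: "A ** (B - C) = A ** B - A ** C" for A :: "real^'n^'m"
  by (simp add: matrix_matrix_mult_def vec_eq_iff right_diff_distrib sum_subtractf)

lemma matrix_sub_rdistrib_real: "(A - B) ** C = A ** C - B ** C" for C :: "real^'n^'m"
  by (simp add: matrix_matrix_mult_def vec_eq_iff left_diff_distrib sum_subtractf)

text \<open>A stochastic \<open>A\<close> fixes the constant columns of
  \<open>averaging_matrix\<close>, and centering kills them, so the right-hand projection is
  absorbed.\<close>

lemma centering_stochastic_centering:
  fixes A :: "real^'n^'n"
  assumes "stochastic A"
  shows "centering_matrix ** A ** centering_matrix = centering_matrix ** A"
proof -
  have "A ** centering_matrix = A - averaging_matrix"
    by (simp add: centering_matrix_eq matrix_sub_ldistrib_real stochastic_mult_averaging[OF assms])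
  moreover have "centering_matrix ** (averaging_matrix :: real^'n^'n) = 0"
    by (simp add: centering_matrix_eq matrix_sub_rdistrib_real
        stochastic_mult_averaging[OF stochastic_averaging_matrix])
  ultimately show ?thesis
    by (simp add: matrix_mul_assoc[symmetric] matrix_sub_ldistrib_real)
qed

lemma complex_centering_nth:
  fixes x :: "complex^'n"
  shows "(complex_matrix centering_matrix *v x) $ i = x $ i - (\<Sum>j\<in>UNIV. x $ j) / of_nat CARD('n)"
proof -
  have "complex_matrix (centering_matrix :: real^'n^'n)
      = mat 1 - (\<chi> i j. 1 / of_nat CARD('n))"
    by (simp add: complex_matrix_def centering_matrix_eq averaging_matrix_def vec_eq_iff mat_def)
  then show ?thesis
    by (simp add: matrix_vector_mult_diff_rdistrib)
      (simp add: matrix_vector_mult_def sum_divide_distrib)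
qed

text \<open>Turns an eigenvector equation modulo constants into a genuine one.\<close>

lemma complex_centering_add_const:
  fixes x :: "complex^'n"
  shows "complex_matrix centering_matrix *v (x + (\<chi> i. c)) = complex_matrix centering_matrix *v x"
  by (simp add: vec_eq_iff complex_centering_nth sum.distrib add_divide_distrib)


section \<open>Products of centered stochastic matrices\<close>

text \<open>For stochastic \<open>A\<close> the projection on the right is absorbed; this is the
  projected matrix in its reduced form.\<close>

definition centered :: "real \<Rightarrow> real^'n^'n \<Rightarrow> real^'n^'n" where
  "centered \<gamma> A = \<gamma> *\<^sub>R (centering_matrix ** A)"

text \<open>The projection intertwines \<open>\<gamma> A\<close> with
  \<open>centered \<gamma> A\<close>, which transports orbits of \<open>A\<close> to orbits of the
  centered matrix.\<close>

lemma complex_centered_vector: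
  assumes "stochastic A"
  shows "complex_matrix (centered \<gamma> A) *v (complex_matrix centering_matrix *v x)
    = of_real \<gamma> *s (complex_matrix centering_matrix *v (complex_matrix A *v x))"
  unfolding centered_def complex_matrix_scaleR_vector
  by (simp add: matrix_vector_mul_assoc centering_stochastic_centering[OF assms]
      flip: complex_matrix_mult)

section \<open>Products along words and their growth\<close>

lemma word_product_Nil: "word_product [] = mat 1"
  by (simp add: word_product_def)

lemma word_product_snoc: "word_product (w @ [A]) = A ** word_product w"
  by (simp add: word_product_def)

lemma complex_word_product_replicate:
  "complex_matrix (word_product (replicate k A)) *v x = (((*v) (complex_matrix A)) ^^ k) x"
proof (induction k)
  case 0
  show ?case
    by (simp add: word_product_Nil complex_matrix_one)
next
  case (Suc k)
  have "replicate (Suc k) A = replicate k A @ [A]"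
    by (simp add: replicate_append_same)
  then show ?case
    using Suc by (simp add: word_product_snoc complex_matrix_mult flip: matrix_vector_mul_assoc
        del: replicate_Suc)
qed

text \<open>Each new factor absorbs the projection in front of the product so far, so only the
  outermost one survives. The empty word is excluded: its product, the identity, does not annihilate
  constants modulo nothing but keeps them, whereas \<open>centering_matrix ** T\<close> maps them to
  zero.\<close>

lemma word_product_centered:
  assumes "set w \<subseteq> centered \<gamma> ` Collect stochastic" "w \<noteq> []"
  shows "\<exists>T. stochastic T \<and> word_product w = \<gamma> ^ length w *\<^sub>R (centering_matrix ** T)"
  using assms
proof (induction w rule: rev_induct)
  case Nil
  then show ?case by simp
next
  case (snoc A w)
  then obtain B where B: "A = centered \<gamma> B" "stochastic B"
    by auto
  show ?case
  proof (cases "w = []")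
    case True
    then show ?thesis
      using B by (intro exI[of _ B]) (simp add: word_product_def centered_def)
  next
    case False
    with snoc obtain T where T: "stochastic T"
      "word_product w = \<gamma> ^ length w *\<^sub>R (centering_matrix ** T)"
      by auto
    have "word_product (w @ [A])
        = \<gamma> ^ Suc (length w) *\<^sub>R ((centering_matrix ** B ** centering_matrix) ** T)"
      by (simp add: word_product_snoc T B centered_def matrix_scalar_ac scalar_matrix_assoc
          matrix_mul_assoc mult.commute)
    then show ?thesis
      using T B stochastic_mult centering_stochastic_centering[OF B(2)]
      by (intro exI[of _ "B ** T"]) (simp add: matrix_mul_assoc)
  qed
qed

text \<open>The entries of \<open>centering_matrix ** T\<close> are differences of two numbers in
  the unit interval. The entrywise bound on the norm is crude, but its constant does not depend on
  the length of the word.\<close>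

lemma onorm_word_product_centered_le:
  fixes w :: "(real^'n^'n) list"
  assumes "set w \<subseteq> centered \<gamma> ` Collect stochastic" "w \<noteq> []" "0 \<le> \<gamma>"
  shows "onorm ((*v) (word_product w)) \<le> (real CARD('n))\<^sup>2 * \<gamma> ^ length w"
proof -
  obtain T where T: "stochastic T" "word_product w = \<gamma> ^ length w *\<^sub>R (centering_matrix ** T)"
    using word_product_centered[OF assms(1,2)] by blast
  have le: "0 \<le> S $ i $ j \<and> S $ i $ j \<le> 1" if "stochastic S" for S :: "real^'n^'n" and i j
    using that member_le_sum[of j UNIV "\<lambda>j. S $ i $ j"] by (simp add: stochastic_def)
  have "\<bar>(centering_matrix ** T) $ i $ j\<bar> \<le> 1" for i j
    using le[OF T(1), of i j] le[OF stochastic_mult[OF stochastic_averaging_matrix T(1)], of i j]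
    by (auto simp: centering_matrix_eq matrix_sub_rdistrib_real abs_le_iff)
  then have "\<bar>word_product w $ i $ j\<bar> \<le> \<gamma> ^ length w" for i j
    using mult_left_mono[of "\<bar>(centering_matrix ** T) $ i $ j\<bar>" 1 "\<gamma> ^ length w"] assms(3)
    by (simp add: T(2) abs_mult)
  from onorm_le_matrix_component[of "word_product w", OF this] show ?thesis
    by (simp add: power2_eq_square)
qed

text \<open>Constant factors disappear under \<open>k\<close>-th roots, so the maxima are squeezed
  towards \<open>\<gamma>\<close>. This also shows that the sequence converges, so that
  \<open>lim\<close> in the definition is a true limit.\<close>

lemma joint_spectral_radius_centered_eq:
  fixes \<M> :: "(real^'n^'n) set"
  assumes fin: "finite \<M>" and sub: "\<M> \<subseteq> centered \<gamma> ` Collect stochastic" and "A \<in> \<M>"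
    and "0 < \<gamma>" "0 < c"
    and lower: "\<And>k. c * \<gamma> ^ k \<le> onorm ((*v) (word_product (replicate k A)))"
  shows "joint_spectral_radius \<M> = \<gamma>"
proof -
  let ?f = "\<lambda>k. Max ((\<lambda>w. root k (onorm ((*v) (word_product w)))) ` {w. length w = k \<and> set w \<subseteq> \<M>})"
  define K where "K = (real CARD('n))\<^sup>2"
  have "0 < K"
    by (simp add: K_def)
  have root_eq: "root k (d * \<gamma> ^ k) = root k d * \<gamma>" if "0 < k" for k d
    using that \<open>0 < \<gamma>\<close> by (simp add: real_root_mult real_root_power_cancel)
  have finw: "finite {w. length w = k \<and> set w \<subseteq> \<M>}" for k
    using finite_lists_length_eq[OF fin, of k] by (simp add: conj_commute)
  have rep: "replicate k A \<in> {w. length w = k \<and> set w \<subseteq> \<M>}" for k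
    using \<open>A \<in> \<M>\<close> by (auto simp: set_replicate_conv_if)
  have lo: "root k c * \<gamma> \<le> ?f k" if "0 < k" for k
  proof -
    have "root k c * \<gamma> \<le> root k (onorm ((*v) (word_product (replicate k A))))"
      using lower[of k] that by (simp flip: root_eq)
    also have "\<dots> \<le> ?f k"
      using finw rep by (intro Max_ge) auto
    finally show ?thesis .
  qed
  have up: "?f k \<le> root k K * \<gamma>" if "0 < k" for k
  proof -
    have "root k (onorm ((*v) (word_product w))) \<le> root k K * \<gamma>"
      if "length w = k" "set w \<subseteq> \<M>" for w
      using onorm_word_product_centered_le[of w \<gamma>] that \<open>0 < k\<close> \<open>0 < \<gamma>\<close> sub
      by (auto simp: K_def simp flip: root_eq)
    moreover have "{w. length w = k \<and> set w \<subseteq> \<M>} \<noteq> {}"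
      using rep by blast
    ultimately show ?thesis
      using finw by (subst Max_le_iff) auto
  qed
  have lim: "(\<lambda>k. root k d * \<gamma>) \<longlonglongrightarrow> \<gamma>" if "0 < d" for d
    using tendsto_mult[OF LIMSEQ_root_const[OF that] tendsto_const[of \<gamma>]] by simp
  have "?f \<longlonglongrightarrow> \<gamma>"
    by (rule tendsto_sandwich[OF _ _ lim[OF \<open>0 < c\<close>] lim[OF \<open>0 < K\<close>]])
      (use lo up in \<open>auto intro!: eventually_sequentiallyI[of 1]\<close>)
  then show ?thesis
    unfolding joint_spectral_radius_def by (rule limI)
qed

section \<open>Eigenvalues of a single centered matrix\<close>

lemma funpow_eigenvector:
  fixes A :: "complex^'n^'n"
  assumes "A *v v = z *s v"
  shows "((*v) A ^^ k) v = z ^ k *s v"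
  by (induction k) (simp_all add: assms vector_scalar_commute vector_smult_assoc)

text \<open>The \<open>k\<close>-th power of \<open>A\<close> stretches \<open>v\<close> by exactly
  \<open>cmod z ^ k\<close>, and complexification does not increase the operator norm.\<close>

lemma eigenvalue_power_le_onorm:
  assumes "complex_matrix A *v v = z *s v" "v \<noteq> 0"
  shows "cmod z ^ k \<le> onorm ((*v) (word_product (replicate k A)))"
proof -
  have "norm (z ^ k *s v) = cmod z ^ k * norm v"
    by (simp add: norm_vec_def L2_set_def norm_mult norm_power power_mult_distrib real_sqrt_mult
        flip: sum_distrib_left)
  then show ?thesis
    using norm_complex_matrix_vector_le[of "word_product (replicate k A)" v] assms
    by (simp add: complex_word_product_replicate funpow_eigenvector)
qed

text \<open>The norms of the powers are at most a constant times \<open>\<gamma> ^ k\<close>; an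
  eigenvalue of larger modulus would eventually outgrow this.\<close>

lemma cmod_eigenvalue_centered_le:
  fixes A :: "real^'n^'n"
  assumes "stochastic A" "0 < \<gamma>" "complex_matrix (centered \<gamma> A) *v v = z *s v" "v \<noteq> 0"
  shows "cmod z \<le> \<gamma>"
proof (rule ccontr)
  assume "\<not> cmod z \<le> \<gamma>"
  then have "1 < cmod z / \<gamma>"
    using assms(2) by simp
  then obtain k where "(real CARD('n))\<^sup>2 < (cmod z / \<gamma>) ^ k"
    using real_arch_pow by blast
  \<comment> \<open>Serves to exclude \<open>k = 0\<close>, since the upper bound concerns nonempty
    words.\<close>
  moreover have "1 \<le> (real CARD('n))\<^sup>2"
    using one_le_power[of "real CARD('n)" 2] by (simp add: Suc_leI)
  ultimately have "k \<noteq> 0"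
    by (intro notI) simp
  have "set (replicate k (centered \<gamma> A)) \<subseteq> centered \<gamma> ` Collect stochastic"
    using assms(1) by (auto simp: set_replicate_conv_if)
  from onorm_word_product_centered_le[OF this] \<open>k \<noteq> 0\<close>
  have "cmod z ^ k \<le> (real CARD('n))\<^sup>2 * \<gamma> ^ k"
    using eigenvalue_power_le_onorm[OF assms(3,4), of k] assms(2) by simp
  then have "(cmod z / \<gamma>) ^ k \<le> (real CARD('n))\<^sup>2"
    using assms(2) by (simp add: power_divide divide_le_eq)
  with \<open>(real CARD('n))\<^sup>2 < (cmod z / \<gamma>) ^ k\<close> show False
    by simp
qed

lemma spec_radius_centered_eq:
  fixes A :: "real^'n^'n"
  assumes "stochastic A" "0 < \<gamma>" "complex_matrix (centered \<gamma> A) *v v = z *s v" "v \<noteq> 0"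
    and "cmod z = \<gamma>"
  shows "spec_radius (centered \<gamma> A) = \<gamma>"
proof -
  let ?p = "complex_charpoly (centered \<gamma> A)"
  have le: "cmod w \<le> \<gamma>" if "poly ?p w = 0" for w
    using that cmod_eigenvalue_centered_le[OF assms(1,2)]
    by (auto simp: poly_complex_charpoly_eq_0_iff)
  \<comment> \<open>The zero polynomial would vanish at \<open>2 * \<gamma>\<close>, against the
    bound on the roots.\<close>
  have "?p \<noteq> 0"
    using le[of "of_real (2 * \<gamma>)"] assms(2) by (auto simp: norm_mult)
  then have "set_mset (eigenvalues (centered \<gamma> A)) = {w. poly ?p w = 0}"
    by (simp add: eigenvalues_def)
  moreover have "poly ?p z = 0"
    using assms(3,4) by (auto simp: poly_complex_charpoly_eq_0_iff)
  ultimately show ?thesis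
    using le assms(5) poly_roots_finite[OF \<open>?p \<noteq> 0\<close>] unfolding spec_radius_def
    by (intro Max_eqI) auto
qed


section \<open>Policies\<close>

lemma stochastic_policy_matrix: "stochastic (policy_matrix \<pi>)"
  by (simp add: stochastic_def policy_matrix_def)

lemma stochastic_transition_kernel: "transition_kernel P \<longleftrightarrow> stochastic P"
  by (simp add: transition_kernel_def stochastic_def)

lemma projected_matrix_eq_centered:
  assumes "transition_kernel P"
  shows "projected_matrix \<gamma> P \<pi> = centered \<gamma> (P ** policy_matrix \<pi>)"
  using centering_stochastic_centering[OF stochastic_mult[OF _ stochastic_policy_matrix], of P \<pi>]
    assms
  by (simp add: projected_matrix_def centered_def stochastic_transition_kernel matrix_scalar_ac
      flip: scalar_matrix_assoc)

lemma complex_policy_matrix_nth: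
  "(complex_matrix (policy_matrix \<pi>) *v x) $ s = x $ (s, \<pi> s)"
  by (simp add: complex_matrix_def policy_matrix_def matrix_vector_mult_def if_distrib if_distribR
      cong: if_cong)

lemma state_transition_matrix_nth: "state_transition_matrix P \<pi> $ s $ s' = P $ (s, \<pi> s) $ s'"
  by (simp add: state_transition_matrix_def policy_matrix_def matrix_matrix_mult_def if_distrib
      if_distribR cong: if_cong)

lemma stochastic_state_transition_matrix:
  "transition_kernel P \<Longrightarrow> stochastic (state_transition_matrix P \<pi>)"
  by (simp add: stochastic_def state_transition_matrix_nth transition_kernel_def)

text \<open>One policy suffices: the upper bound holds for all words, and the words that repeat
  \<open>\<pi>\<close> supply the lower bound.\<close>

lemma joint_spectral_radius_projected_eq:
  assumes P: "transition_kernel P" and "0 < \<gamma>" "0 < c"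
    and lower: "\<And>k. c * \<gamma> ^ k \<le> onorm ((*v) (word_product (replicate k (projected_matrix \<gamma> P \<pi>))))"
  shows "joint_spectral_radius (range (projected_matrix \<gamma> P)) = \<gamma>"
  by (rule joint_spectral_radius_centered_eq[OF _ _ _ assms(2,3) lower])
    (use P stochastic_mult[OF _ stochastic_policy_matrix] in
      \<open>auto simp: projected_matrix_eq_centered stochastic_transition_kernel\<close>)

text \<open>Dividing \<open>X - 1\<close> out of the characteristic polynomial leaves the determinant of
  \<open>X - A\<close> with one column replaced by ones.  Its zeros are the eigenvalues of \<open>A\<close> modulo the
  constant vectors, whether or not \<open>z = 1\<close>.\<close>

lemma second_eigenvalue_eigenvector_mod_const:
  fixes A :: "real^'n^'n"
  assumes "stochastic A" and "is_second_eigenvalue A z"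
  obtains v :: "complex^'n" and c i j where "complex_matrix A *v v = z *s v + (\<chi> i. c)" "v $ i \<noteq> v $ j"
proof -
  \<comment> \<open>Any index will do: it selects the column replaced by ones, and the coordinate
    where the eigenvector is normalised to zero.\<close>
  fix i :: 'n
  let ?X = "mat [:0, 1:] - (\<chi> i j. [:complex_of_real (A $ i $ j):])"
  define q where "q = det (\<chi> r j. if j = i then 1 else ?X $ r $ j)"
  have "(\<Sum>j\<in>UNIV. ?X $ r $ j) = [:-1, 1:]" for r
  proof -
    have "(\<Sum>j\<in>UNIV. ?X $ r $ j) = (\<Sum>j\<in>UNIV. mat [:0, 1:] $ r $ j) -
        (\<Sum>j\<in>UNIV. [:complex_of_real (A $ r $ j):])"
      by (simp add: sum_subtractf)
    also have "(\<Sum>j\<in>UNIV. [:complex_of_real (A $ r $ j):]) = [:of_real (\<Sum>j\<in>UNIV. A $ r $ j):]"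
      by (rule poly_eqI) (simp add: coeff_sum coeff_pCons split: nat.split)
    finally show ?thesis
      using assms(1) by (simp add: stochastic_def mat_def flip: of_real_sum)
  qed
  then have fact: "complex_charpoly A = [:-1, 1:] * q"
    unfolding complex_charpoly_def q_def by (rule det_constant_row_sums)
  \<comment> \<open>By convention \<open>proots 0\<close> is empty, which would leave no second
    eigenvalue.\<close>
  have "q \<noteq> 0"
    using assms(2) fact by (auto simp: is_second_eigenvalue_def eigenvalues_def)
  then have "eigenvalues A = {#1#} + proots q"
    by (simp add: eigenvalues_def fact proots_mult del: mult_pCons_left)
  then have "poly q z = 0"
    using assms(2) \<open>q \<noteq> 0\<close> by (simp add: is_second_eigenvalue_def)
  moreover have "poly q z = det (\<chi> r j. if j = i then 1 else (mat z - complex_matrix A) $ r $ j)"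
    unfolding q_def poly_det
    by (rule arg_cong[where f = det])
      (simp add: vec_eq_iff mat_def complex_matrix_def)
  ultimately obtain x where "x \<noteq> 0"
    and x: "(\<chi> r j. if j = i then 1 else (mat z - complex_matrix A) $ r $ j) *v x = 0"
    by (auto simp: det_eq_0_iff_kernel)
  \<comment> \<open>The coordinate \<open>x $ i\<close> multiplies the column of ones and becomes
    the additive constant; the other coordinates form the eigenvector modulo constants.\<close>
  define v where "v = (\<chi> j. if j = i then 0 else x $ j)"
  have "(mat z - complex_matrix A) *v v + (\<chi> r. x $ i) = 0"
  proof (rule vec_eq_iff[THEN iffD2], rule allI)
    fix r
    have "((mat z - complex_matrix A) *v v) $ r + x $ i
        = (\<Sum>j\<in>UNIV. (mat z - complex_matrix A) $ r $ j * v $ j + (if j = i then x $ i else 0))"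
      by (simp add: matrix_vector_mult_def sum.distrib)
    also have "\<dots> = (\<Sum>j\<in>UNIV. (if j = i then 1 else (mat z - complex_matrix A) $ r $ j) * x $ j)"
      by (rule sum.cong) (auto simp: v_def)
    also have "\<dots> = ((\<chi> r j. if j = i then 1 else (mat z - complex_matrix A) $ r $ j) *v x) $ r"
      by (simp add: matrix_vector_mult_def)
    finally show "((mat z - complex_matrix A) *v v + (\<chi> r. x $ i)) $ r = 0 $ r"
      using x by simp
  qed
  then have eq: "complex_matrix A *v v = z *s v + (\<chi> r. x $ i)"
    by (simp add: matrix_vector_mult_diff_rdistrib mat_vector_mult algebra_simps add_eq_0_iff)
  have "\<exists>j. v $ j \<noteq> v $ i"
  proof (rule ccontr)
    assume "\<nexists>j. v $ j \<noteq> v $ i"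
    then have "v = 0"
      by (auto simp: v_def vec_eq_iff)
    with eq have "x $ i = 0"
      by (simp add: vec_eq_iff)
    with \<open>v = 0\<close> have "x = 0"
      by (auto simp: v_def vec_eq_iff split: if_splits)
    with \<open>x \<noteq> 0\<close> show False ..
  qed
  with that eq show ?thesis
    by blast
qed

text \<open>As \<open>P\<close> fixes constants, an eigenvector \<open>v\<close> of the chain modulo
  constants gives \<open>u = P v\<close> with the same property for
  \<open>P ** policy_matrix \<pi>\<close>; centering removes the constant. At the pairs
  \<open>(r, \<pi> r)\<close> the vector \<open>u\<close> equals \<open>z * v $ r + c\<close>, so
  \<open>z \<noteq> 0\<close> keeps it nonconstant.\<close>

lemma projected_matrix_eigenvector:
  fixes P :: "real^'s^('s::finite \<times> 'a::finite)"
  assumes P: "transition_kernel P" and z: "is_second_eigenvalue (state_transition_matrix P \<pi>) z"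
    and "z \<noteq> 0"
  obtains w where "w \<noteq> 0"
    "complex_matrix (projected_matrix \<gamma> P \<pi>) *v w = (of_real \<gamma> * z) *s w"
proof -
  let ?C = "complex_matrix (centering_matrix :: real^('s \<times> 'a)^('s \<times> 'a))"
  obtain v :: "complex^'s" and c s t where v: "complex_matrix (state_transition_matrix P \<pi>) *v v = z *s v + (\<chi> i. c)"
    and st: "v $ s \<noteq> v $ t"
    using second_eigenvalue_eigenvector_mod_const[OF stochastic_state_transition_matrix[OF P] z]
    by blast
  define u where "u = complex_matrix P *v v"
  have \<Pi>u: "complex_matrix (policy_matrix \<pi>) *v u = z *s v + (\<chi> i. c)"
    using v by (simp add: u_def state_transition_matrix_def complex_matrix_mult matrix_vector_mul_assoc)
  have one: "complex_matrix P *v (\<chi> i. c) = (\<chi> i. c)"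
  proof -
    have "(\<Sum>j\<in>UNIV. complex_of_real (P $ sa $ j) * c) = c" for sa
      using P by (cases sa) (simp add: transition_kernel_def flip: sum_distrib_right of_real_sum)
    then show ?thesis
      by (simp add: complex_matrix_def matrix_vector_mult_def vec_eq_iff)
  qed
  have Mu: "complex_matrix (P ** policy_matrix \<pi>) *v u = z *s u + (\<chi> i. c)"
    by (simp add: complex_matrix_mult \<Pi>u matrix_vector_right_distrib one vector_scalar_commute
        u_def[symmetric] flip: matrix_vector_mul_assoc)
  have "stochastic (P ** policy_matrix \<pi>)"
    using P by (intro stochastic_mult stochastic_policy_matrix)
      (simp add: stochastic_transition_kernel)
  then have "complex_matrix (projected_matrix \<gamma> P \<pi>) *v (?C *v u) = (of_real \<gamma> * z) *s (?C *v u)"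
    by (simp add: projected_matrix_eq_centered[OF P] complex_centered_vector Mu
        complex_centering_add_const vector_scalar_commute vector_smult_assoc)
  moreover have "?C *v u \<noteq> 0"
  proof
    assume 0: "?C *v u = 0"
    have "u $ (r, \<pi> r) = z * v $ r + c" for r
      using complex_policy_matrix_nth[of \<pi> u r] by (simp add: \<Pi>u)
    moreover have "u $ (s, \<pi> s) = u $ (t, \<pi> t)"
      using complex_centering_nth[of u "(s, \<pi> s)"] complex_centering_nth[of u "(t, \<pi> t)"]
      by (simp add: 0)
    ultimately show False
      using st \<open>z \<noteq> 0\<close> by simp
  qed
  ultimately show ?thesis
    using that by blast
qed


section \<open>The transition graph\<close>

text \<open>The left-hand side averages \<open>h\<close> over the states reached from
  \<open>s\<close> in exactly \<open>k\<close> steps.\<close>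

lemma funpow_indicator_const:
  fixes P :: "real^'s^('s::finite \<times> 'a::finite)"
  assumes P: "transition_kernel P"
    and "\<And>r. (s, r) \<in> transitions (state_transition_matrix P \<pi>) ^^ k \<Longrightarrow> h r = c"
  shows "((*v) (complex_matrix (P ** policy_matrix \<pi>)) ^^ k) (\<chi> sa. h (fst sa)) $ (s, \<pi> s) = c"
  using assms(2)
proof (induction k arbitrary: s)
  case 0
  then show ?case by simp
next
  case (Suc k)
  let ?y = "((*v) (complex_matrix (P ** policy_matrix \<pi>)) ^^ k) (\<chi> sa. h (fst sa))"
  have "complex_of_real (P $ (s, \<pi> s) $ r) * ?y $ (r, \<pi> r) = complex_of_real (P $ (s, \<pi> s) $ r) * c"
    for r
  proof (cases "P $ (s, \<pi> s) $ r = 0")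
    case False
    then have "(s, r) \<in> transitions (state_transition_matrix P \<pi>)"
      using P by (simp add: transitions_def state_transition_matrix_nth transition_kernel_def
          order.not_eq_order_implies_strict)
    then have "?y $ (r, \<pi> r) = c"
      using Suc.prems by (intro Suc.IH) (blast intro: relpow_Suc_I2)
    then show ?thesis by simp
  qed simp
  moreover have "((*v) (complex_matrix (P ** policy_matrix \<pi>)) ^^ Suc k) (\<chi> sa. h (fst sa)) $ (s, \<pi> s)
      = (\<Sum>r\<in>UNIV. complex_of_real (P $ (s, \<pi> s) $ r) * ?y $ (r, \<pi> r))"
  proof -
    have "(complex_matrix (P ** policy_matrix \<pi>) *v y) $ sa
        = (\<Sum>r\<in>UNIV. complex_of_real (P $ sa $ r) * (complex_matrix (policy_matrix \<pi>) *v y) $ r)"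
      for y sa
      unfolding complex_matrix_mult matrix_vector_mul_assoc[symmetric]
      by (subst matrix_vector_mult_def) (simp add: complex_matrix_def)
    then show ?thesis
      by (simp add: complex_policy_matrix_nth)
  qed
  moreover have "(\<Sum>r\<in>UNIV. complex_of_real (P $ (s, \<pi> s) $ r)) = 1"
    using P by (simp add: transition_kernel_def flip: of_real_sum)
  ultimately show ?case
    by (simp only: sum_distrib_right[symmetric] mult_1)
qed

text \<open>The two values of the indicator of \<open>B\<close> that are still seen after \<open>k\<close> steps keep
  the oscillation of \<open>M\<^sup>k 1\<^sub>B\<close> equal to one.\<close>

lemma joint_spectral_radius_eq_if_separated:
  fixes P :: "real^'s^('s::finite \<times> 'a::finite)"
  assumes P: "transition_kernel P" and "0 < \<gamma>"
    and sep: "\<And>k. \<exists>s t. (transitions (state_transition_matrix P \<pi>) ^^ k) `` {s} \<subseteq> B \<and>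
                         (transitions (state_transition_matrix P \<pi>) ^^ k) `` {t} \<inter> B = {}"
  shows "joint_spectral_radius (range (projected_matrix \<gamma> P)) = \<gamma>"
proof -
  let ?C = "complex_matrix (centering_matrix :: real^('s \<times> 'a)^('s \<times> 'a))"
  let ?M = "complex_matrix (P ** policy_matrix \<pi>)"
  let ?A = "complex_matrix (projected_matrix \<gamma> P \<pi>)"
  define x :: "complex^('s \<times> 'a)" where "x = (\<chi> sa. indicator B (fst sa))"
  have A: "?A *v (?C *v y) = of_real \<gamma> *s (?C *v (?M *v y))" for y
  proof -
    have "stochastic (P ** policy_matrix \<pi>)"
      using P by (intro stochastic_mult stochastic_policy_matrix)
        (simp add: stochastic_transition_kernel)
    then show ?thesis
      by (simp add: projected_matrix_eq_centered[OF P] complex_centered_vector)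
  qed
  have pow: "((*v) ?A ^^ k) (?C *v x) = of_real \<gamma> ^ k *s (?C *v ((*v) ?M ^^ k) x)" for k
    by (induction k) (simp_all add: vector_scalar_commute A vector_smult_assoc mult.commute)
  \<comment> \<open>Centering preserves differences of coordinates. Two coordinates differ by one,
    so one of them has modulus at least one half.\<close>
  have half: "1 \<le> 2 * norm (?C *v ((*v) ?M ^^ k) x)" for k
  proof -
    obtain s t where s: "(transitions (state_transition_matrix P \<pi>) ^^ k) `` {s} \<subseteq> B"
      and t: "(transitions (state_transition_matrix P \<pi>) ^^ k) `` {t} \<inter> B = {}"
      using sep by blast
    let ?y = "((*v) ?M ^^ k) x"
    have "?y $ (s, \<pi> s) = 1"
      unfolding x_def by (rule funpow_indicator_const[OF P]) (use s in \<open>auto simp: indicator_def\<close>)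
    moreover have "?y $ (t, \<pi> t) = 0"
      unfolding x_def by (rule funpow_indicator_const[OF P]) (use t in \<open>auto simp: indicator_def\<close>)
    ultimately have "(?C *v ?y) $ (s, \<pi> s) - (?C *v ?y) $ (t, \<pi> t) = 1"
      by (simp add: complex_centering_nth)
    then have "1 \<le> cmod ((?C *v ?y) $ (s, \<pi> s)) + cmod ((?C *v ?y) $ (t, \<pi> t))"
      by (metis norm_one norm_triangle_ineq4)
    then show ?thesis
      using Finite_Cartesian_Product.norm_nth_le[of "?C *v ?y" "(s, \<pi> s)"] Finite_Cartesian_Product.norm_nth_le[of "?C *v ?y" "(t, \<pi> t)"] by linarith
  qed
  have pos: "0 < norm (?C *v x)"
    using half[of 0] unfolding funpow_0 by linarith
  show ?thesis
  proof (rule joint_spectral_radius_projected_eq[OF P \<open>0 < \<gamma>\<close>])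
    \<comment> \<open>The constant compares the guaranteed norm \<open>\<gamma> ^ k / 2\<close>
      after \<open>k\<close> steps with the norm of the starting vector.\<close>
    show "0 < 1 / (2 * norm (?C *v x))"
      using pos by simp
    fix k
    let ?W = "word_product (replicate k (projected_matrix \<gamma> P \<pi>))"
    have "norm (of_real \<gamma> ^ k *s y) = \<gamma> ^ k * norm y" for y :: "complex^('s \<times> 'a)"
      using \<open>0 < \<gamma>\<close>
      by (simp add: norm_vec_def L2_set_def norm_mult norm_power power_mult_distrib real_sqrt_mult
          flip: sum_distrib_left)
    then have "\<gamma> ^ k * norm (?C *v ((*v) ?M ^^ k) x) \<le> onorm ((*v) ?W) * norm (?C *v x)"
      using norm_complex_matrix_vector_le[of ?W "?C *v x"]
      by (simp add: complex_word_product_replicate pow)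
    moreover have "\<gamma> ^ k * 1 \<le> \<gamma> ^ k * (2 * norm (?C *v ((*v) ?M ^^ k) x))"
      using half \<open>0 < \<gamma>\<close> by (intro mult_left_mono) auto
    ultimately show "1 / (2 * norm (?C *v x)) * \<gamma> ^ k \<le> onorm ((*v) ?W)"
      using pos by (simp add: field_simps)
  qed
qed

section \<open>Closed communicating classes\<close>

lemma equiv_communicating:
  "equiv UNIV {(i, j). (i, j) \<in> (transitions M)\<^sup>* \<and> (j, i) \<in> (transitions M)\<^sup>*}"
  by (auto simp: equiv_def refl_on_def sym_def trans_def)

lemma closed_class_properties:
  assumes "C \<in> closed_classes M"
  shows "C \<noteq> {}"
    and "i \<in> C \<Longrightarrow> j \<in> C \<Longrightarrow> (i, j) \<in> (transitions M)\<^sup>*"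
    and "i \<in> C \<Longrightarrow> (i, j) \<in> (transitions M)\<^sup>* \<Longrightarrow> j \<in> C"
proof -
  have C: "C \<in> UNIV // {(i, j). (i, j) \<in> (transitions M)\<^sup>* \<and> (j, i) \<in> (transitions M)\<^sup>*}"
    and cl: "transitions M `` C \<subseteq> C"
    using assms by (auto simp: closed_classes_def communicating_classes_def)
  show "C \<noteq> {}"
    using in_quotient_imp_non_empty[OF equiv_communicating C] .
  show "(i, j) \<in> (transitions M)\<^sup>*" if "i \<in> C" "j \<in> C"
    using in_quotient_imp_in_rel[OF equiv_communicating C] that by auto
  show "j \<in> C" if "i \<in> C" "(i, j) \<in> (transitions M)\<^sup>*"
    using that(2,1) by (induction rule: rtrancl_induct) (use cl in auto)
qed

lemma closed_classes_disjoint: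
  assumes "C \<in> closed_classes M" "D \<in> closed_classes M" "C \<noteq> D"
  shows "C \<inter> D = {}"
  using assms quotient_disj[OF equiv_communicating]
  by (fastforce simp: closed_classes_def communicating_classes_def)

text \<open>Take a state \<open>i\<close> with the fewest reachable states. Whatever
  \<open>i\<close> reaches has the same reachable set by minimality, hence leads back to
  \<open>i\<close>.\<close>

lemma closed_classes_nonempty:
  fixes M :: "real^'s^'s"
  shows "closed_classes M \<noteq> {}"
proof -
  let ?R = "(transitions M)\<^sup>*"
  obtain i where i: "\<And>j. card (?R `` {i}) \<le> card (?R `` {j})"
    using ex_has_least_nat[of "\<lambda>_. True" undefined "\<lambda>i. card (?R `` {i})"] by auto
  have return: "(j, i) \<in> ?R" if "(i, j) \<in> ?R" for j
  proof -
    have "?R `` {j} = ?R `` {i}"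
      using that i[of j] by (intro card_seteq) auto
    then show ?thesis
      by blast
  qed
  let ?C = "{(i, j). (i, j) \<in> ?R \<and> (j, i) \<in> ?R} `` {i}"
  have "transitions M `` ?C \<subseteq> ?C"
    using return by (auto intro: rtrancl_into_rtrancl)
  then have "?C \<in> closed_classes M"
    unfolding closed_classes_def communicating_classes_def
    by (intro CollectI conjI quotientI UNIV_I)
  then show ?thesis
    by blast
qed

text \<open>The indicator of \<open>C\<close> separates: the chain never leaves \<open>C\<close>,
  and from \<open>D\<close> it never enters \<open>C\<close>.\<close>

lemma joint_spectral_radius_eq_if_two_closed_classes:
  assumes P: "transition_kernel P" and "0 < \<gamma>"
    and C: "C \<in> closed_classes (state_transition_matrix P \<pi>)"
    and D: "D \<in> closed_classes (state_transition_matrix P \<pi>)" and "C \<noteq> D"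
  shows "joint_spectral_radius (range (projected_matrix \<gamma> P)) = \<gamma>"
proof (rule joint_spectral_radius_eq_if_separated[OF P \<open>0 < \<gamma>\<close>, where B = C])
  fix k
  let ?R = "transitions (state_transition_matrix P \<pi>)"
  obtain s t where "s \<in> C" "t \<in> D"
    using closed_class_properties(1) C D by blast
  have "(?R ^^ k) `` {s} \<subseteq> C"
    using closed_class_properties(3)[OF C \<open>s \<in> C\<close>] relpow_imp_rtrancl by blast
  moreover have "(?R ^^ k) `` {t} \<subseteq> D"
    using closed_class_properties(3)[OF D \<open>t \<in> D\<close>] relpow_imp_rtrancl by blast
  ultimately show "\<exists>s t. (?R ^^ k) `` {s} \<subseteq> C \<and> (?R ^^ k) `` {t} \<inter> C = {}"
    using closed_classes_disjoint[OF C D \<open>C \<noteq> D\<close>] by blast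
qed

lemma stochastic_successor:
  fixes M :: "real^'s^'s"
  assumes "stochastic M"
  shows "\<exists>j. (i, j) \<in> transitions M ^^ k"
proof (induction k)
  case 0
  show ?case by simp
next
  case (Suc k)
  then obtain j where j: "(i, j) \<in> transitions M ^^ k"
    by blast
  have "\<exists>r. 0 < M $ j $ r"
  proof (rule ccontr)
    assume "\<nexists>r. 0 < M $ j $ r"
    then have "(\<Sum>r\<in>UNIV. M $ j $ r) \<le> 0"
      by (intro sum_nonpos) (auto simp: not_less)
    with assms show False
      by (simp add: stochastic_def)
  qed
  with j show ?case
    by (auto simp: transitions_def)
qed

text \<open>In a class of period \<open>d\<close> with base point \<open>i\<close>, the separating set is the cyclic
  subclass of \<open>i\<close>.\<close>

lemma joint_spectral_radius_eq_if_periodic_class: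
  assumes P: "transition_kernel P" and "0 < \<gamma>"
    and C: "C \<in> closed_classes (state_transition_matrix P \<pi>)"
    and per: "periodic_class (state_transition_matrix P \<pi>) C"
  shows "joint_spectral_radius (range (projected_matrix \<gamma> P)) = \<gamma>"
proof -
  let ?M = "state_transition_matrix P \<pi>"
  let ?R = "transitions ?M"
  define d where "d = Gcd (return_times ?M C)"
  have "1 < d"
    using per by (simp add: periodic_class_def d_def)
  obtain i where i: "i \<in> C"
    using closed_class_properties(1)[OF C] by blast
  have ret: "d dvd m" if "(i, i) \<in> ?R ^^ m" for m
  proof (cases "m = 0")
    case False
    then have "m \<in> return_times ?M C"
      using that i by (auto simp: return_times_def)
    then show ?thesis
      unfolding d_def by (rule Gcd_dvd)
  qed simp
  \<comment> \<open>Both paths are closed up by one return path of length \<open>l\<close>; as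
    \<open>d\<close> divides both totals, \<open>m\<close> and \<open>m'\<close> are congruent
    modulo \<open>d\<close>.\<close>
  have same: "d dvd m \<longleftrightarrow> d dvd m'" if "(i, j) \<in> ?R ^^ m" "(i, j) \<in> ?R ^^ m'" for j m m'
  proof -
    have "(j, i) \<in> ?R\<^sup>*"
      using that(1) i closed_class_properties(2,3)[OF C] by (blast dest: relpow_imp_rtrancl)
    then obtain l where l: "(j, i) \<in> ?R ^^ l"
      by (auto simp: rtrancl_power)
    have "d dvd m + l" "d dvd m' + l"
      by (rule ret, unfold relpow_add, rule relcompI, rule that, rule l)+
    then show ?thesis
      using dvd_add_left_iff[of d l m] dvd_add_left_iff[of d l m']
        dvd_add_right_iff[of d m l] dvd_add_right_iff[of d m' l] by blast
  qed
  define B where "B = {j. \<exists>m. (i, j) \<in> ?R ^^ m \<and> d dvd m}"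
  have B_iff: "j \<in> B \<longleftrightarrow> d dvd m" if "(i, j) \<in> ?R ^^ m" for j m
    unfolding B_def using that same[OF that] by blast
  show ?thesis
  proof (rule joint_spectral_radius_eq_if_separated[OF P \<open>0 < \<gamma>\<close>, where B = B])
    fix k
    \<comment> \<open>The choice \<open>(d - 1) * k\<close> makes \<open>m + k\<close> a multiple of
      \<open>d\<close>. A state \<open>m\<close> steps from \<open>i\<close> is thus in
      \<open>B\<close> after \<open>k\<close> further steps, while one extra initial step shifts the
      residue to 1 and misses \<open>B\<close>.\<close>
    obtain m where m: "d dvd m + k"
    proof
      have "(d - 1) * k + k = d * k"
        using \<open>1 < d\<close> by (cases d) auto
      then show "d dvd (d - 1) * k + k"
        by simp
    qed
    obtain s where s: "(i, s) \<in> ?R ^^ m"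
      using stochastic_successor[OF stochastic_state_transition_matrix[OF P]] by blast
    obtain t where t: "(i, t) \<in> ?R ^^ Suc m"
      using stochastic_successor[OF stochastic_state_transition_matrix[OF P]] by blast
    have nd: "\<not> d dvd Suc m + k"
      using dvd_add_right_iff[OF m, of 1] \<open>1 < d\<close> by simp
    have "(?R ^^ k) `` {s} \<subseteq> B"
    proof
      fix r
      assume "r \<in> (?R ^^ k) `` {s}"
      then have "(i, r) \<in> ?R ^^ (m + k)"
        unfolding relpow_add using s by blast
      from B_iff[OF this] m show "r \<in> B"
        by blast
    qed
    moreover have "(?R ^^ k) `` {t} \<inter> B = {}"
    proof -
      have "r \<notin> B" if "(t, r) \<in> ?R ^^ k" for r
      proof -
        have "(i, r) \<in> ?R ^^ (Suc m + k)"
          unfolding relpow_add using t that by blast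
        from B_iff[OF this] nd show ?thesis
          by blast
      qed
      then show ?thesis
        by blast
    qed
    ultimately show "\<exists>s t. (?R ^^ k) `` {s} \<subseteq> B \<and> (?R ^^ k) `` {t} \<inter> B = {}"
      by blast
  qed
qed

theorem mainTheorem6:
  fixes P :: "real^'s^('s::finite \<times> 'a::finite)"
    and \<gamma> :: real
  assumes "transition_kernel P"
    and "0 < \<gamma>" and "\<gamma> < 1"
  shows "(\<forall>\<pi>. (\<exists>z. is_second_eigenvalue (state_transition_matrix P \<pi>) z \<and> cmod z = 1) \<longrightarrow>
            spec_radius (projected_matrix \<gamma> P \<pi>) = \<gamma> \<and>
            joint_spectral_radius (range (projected_matrix \<gamma> P)) = \<gamma>)
       \<and> (\<forall>\<pi>. card (closed_classes (state_transition_matrix P \<pi>)) > 1 \<or>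
              (\<exists>C\<in>closed_classes (state_transition_matrix P \<pi>).
                 periodic_class (state_transition_matrix P \<pi>) C) \<longrightarrow>
            joint_spectral_radius (range (projected_matrix \<gamma> P)) = \<gamma>)
       \<and> (joint_spectral_radius (range (projected_matrix \<gamma> P)) < \<gamma> \<longrightarrow>
            (\<forall>\<pi>. unichain_aperiodic (state_transition_matrix P \<pi>)))"
proof (intro conjI allI impI)
  fix \<pi> :: "'s \<Rightarrow> 'a"
  assume "\<exists>z. is_second_eigenvalue (state_transition_matrix P \<pi>) z \<and> cmod z = 1"
  then obtain z where z: "is_second_eigenvalue (state_transition_matrix P \<pi>) z" "cmod z = 1"
    by blast
  then have "z \<noteq> 0"
    by auto
  obtain w where w: "w \<noteq> 0"
    "complex_matrix (projected_matrix \<gamma> P \<pi>) *v w = (of_real \<gamma> * z) *s w"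
    using projected_matrix_eigenvector[OF assms(1) z(1) \<open>z \<noteq> 0\<close>] .
  have cmod: "cmod (of_real \<gamma> * z) = \<gamma>"
    using z assms(2) by (simp add: norm_mult)
  have "stochastic (P ** policy_matrix \<pi>)"
    using assms(1) by (intro stochastic_mult stochastic_policy_matrix)
      (simp add: stochastic_transition_kernel)
  then show "spec_radius (projected_matrix \<gamma> P \<pi>) = \<gamma>"
    using spec_radius_centered_eq[OF _ assms(2) _ w(1) cmod] w(2)
    by (simp add: projected_matrix_eq_centered[OF assms(1)])
  \<comment> \<open>The eigenvalue \<open>\<gamma> * z\<close> has modulus \<open>\<gamma>\<close>,
    so the lower bound holds with constant one.\<close>
  show "joint_spectral_radius (range (projected_matrix \<gamma> P)) = \<gamma>"
    using eigenvalue_power_le_onorm[OF w(2,1)] cmod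
    by (intro joint_spectral_radius_projected_eq[OF assms(1,2) zero_less_one, of \<pi>]) simp
next
  fix \<pi> :: "'s \<Rightarrow> 'a"
  let ?M = "state_transition_matrix P \<pi>"
  assume "card (closed_classes ?M) > 1 \<or> (\<exists>C\<in>closed_classes ?M. periodic_class ?M C)"
  then show "joint_spectral_radius (range (projected_matrix \<gamma> P)) = \<gamma>"
  proof
    assume "card (closed_classes ?M) > 1"
    then obtain C D where "C \<in> closed_classes ?M" "D \<in> closed_classes ?M" "C \<noteq> D"
      using card_le_Suc0_iff_eq[OF card_ge_0_finite, of "closed_classes ?M"] by (auto simp: not_le)
    then show ?thesis
      by (rule joint_spectral_radius_eq_if_two_closed_classes[OF assms(1,2)])
  qed (use joint_spectral_radius_eq_if_periodic_class[OF assms(1,2)] in blast)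
next
  fix \<pi> :: "'s \<Rightarrow> 'a"
  assume "joint_spectral_radius (range (projected_matrix \<gamma> P)) < \<gamma>"
  then have ne: "joint_spectral_radius (range (projected_matrix \<gamma> P)) \<noteq> \<gamma>"
    by simp
  \<comment> \<open>Finiteness gives a closed class; a second or a periodic one would force equality
    with \<open>\<gamma>\<close>.\<close>
  show "unichain_aperiodic (state_transition_matrix P \<pi>)"
    unfolding unichain_aperiodic_def unichain_def
  proof (intro conjI ballI notI)
    obtain C where C: "C \<in> closed_classes (state_transition_matrix P \<pi>)"
      using closed_classes_nonempty by blast
    show "\<exists>!C. C \<in> closed_classes (state_transition_matrix P \<pi>)"
    proof (rule ex1I[of _ C])
      show "C \<in> closed_classes (state_transition_matrix P \<pi>)"
        by (rule C)
    next
      fix D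
      assume "D \<in> closed_classes (state_transition_matrix P \<pi>)"
      then show "D = C"
        using joint_spectral_radius_eq_if_two_closed_classes[OF assms(1,2) C] ne by blast
    qed
  qed (use joint_spectral_radius_eq_if_periodic_class[OF assms(1,2)] ne in blast)
qed

end
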